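(* Assume that $\mathbf{P}(|X|>x)=L(x)x^{-r}$ for some $r>1$, where $L$ is slowly varying at infinity, and that $$\frac{\mathbf{P}(X>x)}{\mathbf{P}(|X|>x)}\to p\in(0,1)\quad\text{as }x\to\infty.$$ Then $$\limsup_{x\to\infty}\frac{\mathbf{P}(M_\tau>x)}{\mathbf{P}(X>x)}\le \mathbf{E}[\tau_z]$$ for every $z>0$.
   Context: $X_1,X_2,\ldots$ are independent copies of a real random variable $X$ with finite mean and $a:=-\mathbf{E}[X]>0$. $S_0:=0$ and $S_n:=\sum_{i=1}^n X_i$ for $n\ge1$. For $z>0$, $\tau_z:=\min\{k\ge 0: S_k\le -z\}$ (almost surely finite, with finite mean), and $M_\tau:=\max_{1\le k\le \tau_z}S_k$ (so $M_\tau$ depends on $z$). *)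

theory Defs
  imports "HOL-Probability.Probability"
begin

(* L is only required to be positive and measurable on some half-line [A, \<infinity>),
   so its values elsewhere are irrelevant. *)
definition slowly_varying :: "(real \<Rightarrow> real) \<Rightarrow> bool" where
  "slowly_varying L \<longleftrightarrow>
     (\<exists>A. (\<forall>x\<ge>A. 0 < L x) \<and> L \<in> borel_measurable (restrict_space borel {A..})) \<and>
     (\<forall>c>0. ((\<lambda>x. L (c * x) / L x) \<longlongrightarrow> 1) at_top)"

(* The increments are indexed from 1; Y 0 is never used. *)
definition random_walk :: "(nat \<Rightarrow> 'a \<Rightarrow> real) \<Rightarrow> nat \<Rightarrow> 'a \<Rightarrow> real" where
  "random_walk Y n \<omega> = (\<Sum>i=1..n. Y i \<omega>)"

(* Unspecified at those \<omega> for which the level -z is never reached; for a walk with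
   i.i.d. increments of negative mean these form a null set. *)
definition passage_time :: "(nat \<Rightarrow> 'a \<Rightarrow> real) \<Rightarrow> real \<Rightarrow> 'a \<Rightarrow> nat" where
  "passage_time Y z \<omega> = (LEAST k. random_walk Y k \<omega> \<le> - z)"

(* For z > 0 the passage time, where the level is reached, is at least 1, so the
   maximum is over a nonempty set. *)
definition passage_max :: "(nat \<Rightarrow> 'a \<Rightarrow> real) \<Rightarrow> real \<Rightarrow> 'a \<Rightarrow> real" where
  "passage_max Y z \<omega> = Max ((\<lambda>k. random_walk Y k \<omega>) ` {1..passage_time Y z \<omega>})"

end

theory Submission
  imports Defs
begin

text \<open>
  Everything is reduced to one-step recursions for the probability \<open>u x n s\<close> that the walk started
  at \<open>s\<close> exceeds \<open>x\<close> within \<open>n\<close> steps and before reaching \<open>- z\<close>. To exceed \<open>x\<close> from \<open>0\<close>, the walk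
  must either make a step larger than \<open>(1 - e) * x\<close> before the passage time, which has probability
  at most \<open>E[\<tau>] * P(X > (1 - e) * x)\<close>, or exceed \<open>e / 2 * x\<close> first and then climb from a level below
  \<open>(1 - e / 2) * x\<close> to \<open>x\<close>. The latter climb has small probability, by comparison with a
  supersolution that is the sum of an exponential and a linear function. Hence, for every \<open>q > 0\<close>
  and all large \<open>x\<close>,
  \<open>u x n 0 \<le> E[\<tau>] * P(X > (1 - e) * x) + q * u (e / 2 * x) n 0\<close>.
  With \<open>e = 1 / 2\<close>, iteration gives \<open>u x n 0 = O(P(X > x))\<close> by regular variation; inserting this
  into the inequality and letting \<open>x \<rightarrow> \<infinity>\<close>, \<open>q \<rightarrow> 0\<close> and \<open>e \<rightarrow> 0\<close> yields the claim.
\<close>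

section \<open>Walks stopped on leaving a set and their one-step recursions\<close>

text \<open>Freezing the path at its first exit from \<open>R\<close> turns an event about all times
  up to \<open>n\<close> into an event about the position at time \<open>n\<close> alone. As in
  \<open>random_walk\<close>, the increments start at index 1.\<close>

fun absorbed_walk :: "real set \<Rightarrow> (nat \<Rightarrow> real) \<Rightarrow> nat \<Rightarrow> real" where
  "absorbed_walk R y 0 = 0"
| "absorbed_walk R y (Suc n) =
     (if absorbed_walk R y n \<in> R then absorbed_walk R y n + y (Suc n) else absorbed_walk R y n)"

text \<open>The mean of \<open>f\<close> at time \<open>n\<close> for the walk with step law \<open>\<mu>\<close> started at \<open>s\<close> and stopped on
  leaving \<open>R\<close>, computed by conditioning on the first step.\<close>

fun absorbed_mean :: "real measure \<Rightarrow> real set \<Rightarrow> (real \<Rightarrow> real) \<Rightarrow> nat \<Rightarrow> real \<Rightarrow> real" where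
  "absorbed_mean \<mu> R f 0 s = f s"
| "absorbed_mean \<mu> R f (Suc n) s =
     (if s \<in> R then \<integral>y. absorbed_mean \<mu> R f n (s + y) \<partial>\<mu> else f s)"

text \<open>This is \<open>u x n s\<close> of the overview: the stopped walk sits above
  \<open>x\<close> at time \<open>n\<close> iff it left \<open>{-z<..x}\<close> through the top by
  then.\<close>

definition overshoot :: "real measure \<Rightarrow> real \<Rightarrow> real \<Rightarrow> nat \<Rightarrow> real \<Rightarrow> real" where
  "overshoot \<mu> z x = absorbed_mean \<mu> {-z<..x} (indicator {x<..})"

text \<open>For \<open>s = 0\<close> this is P(\<tau> > n), so its sum over \<open>n\<close> is
  E[\<tau>] and its partial sums are E[min(\<tau>, n)].\<close>

definition survival :: "real measure \<Rightarrow> real \<Rightarrow> nat \<Rightarrow> real \<Rightarrow> real" where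
  "survival \<mu> z = absorbed_mean \<mu> {-z<..} (indicator {-z<..})"

lemma absorbed_mean_outside: "s \<notin> R \<Longrightarrow> absorbed_mean \<mu> R f n s = f s"
  by (cases n) auto

context real_distribution
begin

lemma prob_UNIV: "prob UNIV = 1"
  using prob_space by simp

lemma measurable_absorbed_mean [measurable]:
  assumes [measurable]: "R \<in> sets borel" "f \<in> borel_measurable borel"
  shows "absorbed_mean M R f n \<in> borel_measurable borel"
proof (induction n)
  case 0
  then show ?case by (simp add: assms(2))
next
  case (Suc n)
  note [measurable] = Suc
  show ?case by simp measurable
qed

lemma absorbed_mean_bounds:
  assumes [measurable]: "R \<in> sets borel" "f \<in> borel_measurable borel"
    and f: "\<And>s. 0 \<le> f s" "\<And>s. f s \<le> 1"
  shows "0 \<le> absorbed_mean M R f n s" "absorbed_mean M R f n s \<le> 1"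
proof -
  have "\<forall>s. 0 \<le> absorbed_mean M R f n s \<and> absorbed_mean M R f n s \<le> 1"
  proof (induction n)
    case 0
    then show ?case using f by simp
  next
    case (Suc n)
    have "integrable M (\<lambda>y. absorbed_mean M R f n (s + y))" for s
      by (rule integrable_const_bound[where B=1]) (use Suc in auto)
    then have "(\<integral>y. absorbed_mean M R f n (s + y) \<partial>M) \<le> 1" for s
      using integral_le_const[of "\<lambda>y. absorbed_mean M R f n (s + y)" 1] Suc by auto
    then show ?case using f Suc by (auto intro: integral_nonneg)
  qed
  then show "0 \<le> absorbed_mean M R f n s" "absorbed_mean M R f n s \<le> 1" by auto
qed

lemma
  shows measurable_overshoot [measurable]: "overshoot M z x n \<in> borel_measurable borel"
    and overshoot_nonneg: "0 \<le> overshoot M z x n s"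
    and overshoot_le_1: "overshoot M z x n s \<le> 1"
  unfolding overshoot_def by (auto intro!: absorbed_mean_bounds simp: indicator_def)

lemma
  shows measurable_survival [measurable]: "survival M z n \<in> borel_measurable borel"
    and survival_nonneg: "0 \<le> survival M z n s"
    and survival_le_1: "survival M z n s \<le> 1"
  unfolding survival_def by (auto intro!: absorbed_mean_bounds simp: indicator_def)

lemma integrable_overshoot: "integrable M (\<lambda>y. overshoot M z x n (s + y))"
  by (rule integrable_const_bound[where B=1]) (auto simp: overshoot_nonneg overshoot_le_1)

lemma integrable_survival: "integrable M (\<lambda>y. survival M z n (s + y))"
  by (rule integrable_const_bound[where B=1]) (auto simp: survival_nonneg survival_le_1)

lemma overshoot_above: "x < s \<Longrightarrow> overshoot M z x n s = 1"
  by (simp add: overshoot_def absorbed_mean_outside)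

lemma overshoot_below: "s \<le> -z \<Longrightarrow> 0 \<le> x + z \<Longrightarrow> overshoot M z x n s = 0"
  by (simp add: overshoot_def absorbed_mean_outside)

lemma overshoot_0: "s \<le> x \<Longrightarrow> overshoot M z x 0 s = 0"
  by (simp add: overshoot_def)

lemma overshoot_Suc:
  "-z < s \<Longrightarrow> s \<le> x \<Longrightarrow> overshoot M z x (Suc n) s = (\<integral>y. overshoot M z x n (s + y) \<partial>M)"
  by (simp add: overshoot_def)

lemma survival_below: "s \<le> -z \<Longrightarrow> survival M z n s = 0"
  by (simp add: survival_def absorbed_mean_outside)

text \<open>First-step analysis of E[min(\<tau>, n)]: one unit for the current step, then the
  expected remaining time from the new position.\<close>

lemma sum_survival_Suc:
  assumes "-z < s"
  shows "(\<Sum>k<Suc n. survival M z k s) = 1 + (\<integral>y. (\<Sum>k<n. survival M z k (s + y)) \<partial>M)"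
proof -
  have "(\<Sum>k<Suc n. survival M z k s) = survival M z 0 s + (\<Sum>k<n. survival M z (Suc k) s)"
    by (rule sum.lessThan_Suc_shift)
  also have "(\<Sum>k<n. survival M z (Suc k) s) = (\<Sum>k<n. \<integral>y. survival M z k (s + y) \<partial>M)"
    using assms by (simp add: survival_def)
  also have "\<dots> = (\<integral>y. (\<Sum>k<n. survival M z k (s + y)) \<partial>M)"
    by (simp add: integrable_survival)
  also have "survival M z 0 s = 1" using assms by (simp add: survival_def)
  finally show ?thesis .
qed

lemma integrable_sum_survival: "integrable M (\<lambda>y. \<Sum>k<n. survival M z k (s + y))"
  by (simp add: integrable_survival)

end

section \<open>A recursive inequality for tails\<close>

text \<open>Passing from \<open>x\<close> to \<open>x / 4\<close> costs a factor of at most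
  \<open>A\<close> in \<open>F\<close>, while the recursion contributes \<open>1 / (2 * A)\<close>.
  So the bound \<open>K * F\<close> returns with constant \<open>K / 2\<close>, and the other half
  of \<open>K\<close> pays for the term with \<open>T\<close>. On \<open>x \<le> 4 * x0\<close> the
  trivial bound \<open>G \<le> 1\<close> starts the iteration.\<close>

lemma tail_recursion_bound:
  fixes F G :: "real \<Rightarrow> real"
  assumes "0 < x0" and F: "\<And>x. 0 < F x" "antimono F" and "0 < A" and "0 \<le> T"
    and dom: "\<And>x. x \<ge> x0 \<Longrightarrow> F (x / 4) \<le> A * F x"
    and G: "\<And>x. G x \<le> 1"
    and rec: "\<And>x. x \<ge> x0 \<Longrightarrow> G x \<le> T * F (x / 2) + G (x / 4) / (2 * A)"
    and x: "x \<ge> x0"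
  shows "G x \<le> max (2 * T * A) (1 / F (4 * x0)) * F x"
proof -
  define K where "K = max (2 * T * A) (1 / F (4 * x0))"
  have K: "2 * T * A \<le> K" "1 / F (4 * x0) \<le> K" by (auto simp: K_def)
  have base: "G x \<le> K * F x" if "x \<le> 4 * x0" for x
  proof -
    have "1 = 1 / F (4 * x0) * F (4 * x0)" using F(1)[of "4 * x0"] by simp
    also have "\<dots> \<le> K * F x"
      using K F(1)[of "4 * x0"] antimonoD[OF F(2) that] by (intro mult_mono) (auto intro: order_trans[OF _ K(2)])
    finally show ?thesis using G[of x] by linarith
  qed
  \<comment> \<open>Induction over the ranges up to \<open>4 ^ n * x0\<close>: for
    \<open>x > 4 * x0\<close> the point \<open>x / 4\<close> lies in the previous range and is still
    at least \<open>x0\<close>.\<close>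
  have "x0 \<le> x \<longrightarrow> x \<le> 4 ^ n * x0 \<longrightarrow> G x \<le> K * F x" for n
  proof (induction n arbitrary: x)
    case 0
    then show ?case using base[of x] \<open>0 < x0\<close> by auto
  next
    case (Suc n)
    show ?case
    proof (intro impI)
      assume x: "x0 \<le> x" "x \<le> 4 ^ Suc n * x0"
      show "G x \<le> K * F x"
      proof (cases "x \<le> 4 * x0")
        case False
        have "G (x / 4) \<le> K * F (x / 4)" using Suc.IH[of "x / 4"] x False by auto
        also have "\<dots> \<le> K * (A * F x)"
          using dom[OF x(1)] K(1) \<open>0 < A\<close> \<open>0 \<le> T\<close>
          by (intro mult_left_mono) (auto intro: order_trans[OF _ K(1)])
        finally have 1: "G (x / 4) / (2 * A) \<le> K * F x / 2" using \<open>0 < A\<close> by (simp add: field_simps)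
        have "F (x / 2) \<le> F (x / 4)" using x \<open>0 < x0\<close> by (intro antimonoD[OF F(2)]) auto
        also have "\<dots> \<le> A * F x" using dom[OF x(1)] .
        finally have "T * F (x / 2) \<le> T * (A * F x)" using \<open>0 \<le> T\<close> by (rule mult_left_mono)
        also have "\<dots> \<le> K / 2 * F x"
          using K(1) mult_right_mono[of "T * A" "K / 2" "F x"] F(1)[of x] by (simp add: mult.assoc)
        finally show ?thesis using rec[OF x(1)] 1 by simp
      qed (rule base)
    qed
  qed
  moreover obtain n where "x / x0 < 4 ^ n" using real_arch_pow[of 4 "x / x0"] by auto
  then have "x \<le> 4 ^ n * x0" using \<open>0 < x0\<close> by (simp add: field_simps)
  ultimately show ?thesis using x by (simp add: K_def)
qed

section \<open>Estimates under negative drift\<close>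

locale negative_drift = real_distribution +
  assumes integrable_step: "integrable M (\<lambda>y. y)"
    and mean_neg: "(\<integral>y. y \<partial>M) < 0"
begin

lemma integrable_max_step: "integrable M (\<lambda>y. max y (- B))"
  by (intro integrable_max integrable_step) auto

text \<open>By dominated convergence, cutting the steps off below at a distant level keeps the mean
  negative. With steps bounded below, a linear function shifted by \<open>B\<close> stays
  nonnegative after the step that crosses \<open>- z\<close>, and so can serve as a
  supersolution.\<close>

lemma truncated_drift_neg: "\<exists>B\<ge>0. (\<integral>y. max y (- B) \<partial>M) < 0"
proof -
  have "((\<lambda>B. \<integral>y. max y (- B) \<partial>M) \<longlongrightarrow> (\<integral>y. y \<partial>M)) at_top"
  proof (rule integral_dominated_convergence_at_top[where w="\<lambda>y. \<bar>y\<bar>"])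
    show "AE y in M. ((\<lambda>B. max y (- B)) \<longlongrightarrow> y) at_top"
    proof (rule AE_I2)
      fix y :: real
      have "\<forall>\<^sub>F B in at_top. y = max y (- B)"
        using eventually_ge_at_top[of "-y"] by eventually_elim auto
      then show "((\<lambda>B. max y (- B)) \<longlongrightarrow> y) at_top"
        by (rule tendsto_eventually[OF eventually_mono]) simp
    qed
    show "\<forall>\<^sub>F B in at_top. AE y in M. norm (max y (- B)) \<le> \<bar>y\<bar>"
      using eventually_ge_at_top[of 0] by eventually_elim (auto simp: max_def)
  qed (auto intro: integrable_step)
  then have "\<forall>\<^sub>F B in at_top. (\<integral>y. max y (- B) \<partial>M) < 0"
    using mean_neg by (rule order_tendstoD)
  then have "\<forall>\<^sub>F B in at_top. B \<ge> 0 \<and> (\<integral>y. max y (- B) \<partial>M) < 0"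
    using eventually_ge_at_top[of 0] by eventually_elim auto
  then show ?thesis
    by (auto dest: eventually_happens)
qed

text \<open>A Wald-type bound: under the truncated steps the right-hand side falls by exactly 1 in
  mean per step, so it dominates the recursion \<open>sum_survival_Suc\<close>.\<close>

lemma sum_survival_le:
  assumes B: "0 \<le> B" and neg: "(\<integral>y. max y (- B) \<partial>M) < 0" and s: "- z < s"
  shows "(\<Sum>k<n. survival M z k s) \<le> (s + z + B) / - (\<integral>y. max y (- B) \<partial>M)"
  using s
proof (induction n arbitrary: s)
  case 0
  then show ?case using B neg by (auto simp: divide_nonneg_neg divide_le_0_iff)
next
  case (Suc n)
  define a where "a = - (\<integral>y. max y (- B) \<partial>M)"
  have a: "a > 0" using neg by (simp add: a_def)
  have "(\<integral>y. (\<Sum>k<n. survival M z k (s + y)) \<partial>M) \<le> (\<integral>y. (s + z + B + max y (-B)) / a \<partial>M)"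
  proof (rule integral_mono)
    fix y
    show "(\<Sum>k<n. survival M z k (s + y)) \<le> (s + z + B + max y (-B)) / a"
    proof (cases "- z < s + y")
      case True
      have "(\<Sum>k<n. survival M z k (s + y)) \<le> (s + y + z + B) / a"
        using Suc.IH[OF True] by (simp add: a_def)
      also have "\<dots> \<le> (s + z + B + max y (-B)) / a"
        using a by (intro divide_right_mono) auto
      finally show ?thesis .
    next
      case False
      then show ?thesis using a Suc.prems by (simp add: survival_below)
    qed
  qed (intro integrable_sum_survival integrable_divide Bochner_Integration.integrable_add
      integrable_max_step integrable_const)+
  also have "\<dots> = (s + z + B) / a - 1"
    using a by (simp add: integrable_max_step prob_UNIV a_def field_simps)
  finally show ?case
    using sum_survival_Suc[OF Suc.prems, of n] by (simp add: a_def)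
qed

text \<open>With \<open>h = c / x\<close>, the quotient \<open>(exp (h * min y x) - 1) / h\<close>
  tends to \<open>y\<close> as \<open>x\<close> grows. Truncation at \<open>x\<close> keeps the
  exponent below \<open>c\<close>, so \<open>exp c * \<bar>y\<bar>\<close> dominates, and the
  integrals converge to the negative mean.\<close>

lemma exp_truncated_le_1:
  assumes c: "c > 0"
  shows "\<forall>\<^sub>F x in at_top. integrable M (\<lambda>y. exp (c / x * min y x)) \<and>
    (\<integral>y. exp (c / x * min y x) \<partial>M) \<le> 1"
proof -
  have int: "integrable M (\<lambda>y. exp (c / x * min y x))" if "x > 0" for x
  proof (rule integrable_const_bound[where B="exp c"])
    have "c / x * min y x \<le> c" for y
    proof -
      have "c / x * min y x \<le> c / x * x" using c that by (intro mult_left_mono) auto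
      then show ?thesis using that by simp
    qed
    then show "AE y in M. norm (exp (c / x * min y x)) \<le> exp c" by simp
  qed simp
  have bound: "\<bar>exp w - 1\<bar> \<le> exp c * \<bar>w\<bar>" if "w \<le> c" for w
  proof (cases "w \<ge> 0")
    case True
    have "1 - w \<le> exp (- w)" using exp_ge_add_one_self[of "-w"] by simp
    then have "exp w * (1 - w) \<le> exp w * exp (- w)" by (intro mult_left_mono) auto
    then have "exp w - 1 \<le> exp w * w" by (simp add: algebra_simps flip: exp_add)
    also have "\<dots> \<le> exp c * w" using that True by (intro mult_right_mono) auto
    finally show ?thesis using True by simp
  next
    case False
    have "1 - exp w \<le> - w" using exp_ge_add_one_self[of w] by linarith
    also have "\<dots> \<le> exp c * (- w)" using False c
      using mult_right_mono[of 1 "exp c" "-w"] by simp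
    finally show ?thesis using False by simp
  qed
  have "((\<lambda>x. \<integral>y. (exp (c / x * min y x) - 1) / (c / x) \<partial>M) \<longlongrightarrow> (\<integral>y. y \<partial>M)) at_top"
  proof (rule integral_dominated_convergence_at_top[where w="\<lambda>y. exp c * \<bar>y\<bar>"])
    show "AE y in M. ((\<lambda>x. (exp (c / x * min y x) - 1) / (c / x)) \<longlongrightarrow> y) at_top"
    proof (rule AE_I2)
      fix y :: real
      \<comment> \<open>For fixed \<open>y\<close> the truncation is inactive once
        \<open>x \<ge> y\<close>, so the limit is first taken without it.\<close>
      have "((\<lambda>x. (exp (c / x * y) - 1) / (c / x)) \<longlongrightarrow> y) at_top"
      proof (cases "y = 0")
        case False
        have lim0: "((\<lambda>x. c / x * y) \<longlongrightarrow> 0) at_top" 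
          by (intro tendsto_mult_left_zero tendsto_divide_0[OF tendsto_const])
             (simp add: filterlim_at_top_imp_at_infinity filterlim_ident)
        have "((\<lambda>w::real. (exp w - 1) / w) \<longlongrightarrow> 1) (at 0)"
          using DERIV_exp[of "0::real"] by (simp add: has_field_derivative_iff)
        moreover have "filterlim (\<lambda>x. c / x * y) (at 0) at_top"
          using lim0 False c eventually_gt_at_top[of 0]
          by (auto simp: filterlim_at elim: eventually_mono)
        ultimately have "((\<lambda>x. (exp (c / x * y) - 1) / (c / x * y)) \<longlongrightarrow> 1) at_top"
          by (rule filterlim_compose)
        then have "((\<lambda>x. (exp (c / x * y) - 1) / (c / x * y) * y) \<longlongrightarrow> 1 * y) at_top"
          by (intro tendsto_intros)
        then show ?thesis using False by simp
      qed simp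
      moreover have "\<forall>\<^sub>F x in at_top. (exp (c / x * y) - 1) / (c / x) = (exp (c / x * min y x) - 1) / (c / x)"
        using eventually_ge_at_top[of y] by eventually_elim simp
      ultimately show "((\<lambda>x. (exp (c / x * min y x) - 1) / (c / x)) \<longlongrightarrow> y) at_top"
        by (rule Lim_transform_eventually)
    qed
    show "\<forall>\<^sub>F x in at_top. AE y in M. norm ((exp (c / x * min y x) - 1) / (c / x)) \<le> exp c * \<bar>y\<bar>"
      using eventually_gt_at_top[of 0]
    proof eventually_elim
      case (elim x)
      have "\<bar>exp (c / x * min y x) - 1\<bar> / (c / x) \<le> exp c * \<bar>y\<bar>" for y
      proof -
        have "c / x * min y x \<le> c / x * x" using c elim by (intro mult_left_mono) auto
        then have "\<bar>exp (c / x * min y x) - 1\<bar> \<le> exp c * \<bar>c / x * min y x\<bar>"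
          using elim by (intro bound) auto
        also have "\<dots> = exp c * (c / x * \<bar>min y x\<bar>)" using c elim by (simp add: abs_mult)
        also have "\<dots> \<le> exp c * (c / x * \<bar>y\<bar>)" using c elim
          by (intro mult_left_mono) auto
        finally show ?thesis using c elim by (simp add: field_simps)
      qed
      then show ?case using c elim by (intro AE_I2) (simp add: abs_mult)
    qed
  qed (auto intro: integrable_step)
  then have "\<forall>\<^sub>F x in at_top. (\<integral>y. (exp (c / x * min y x) - 1) / (c / x) \<partial>M) < 0"
    using mean_neg by (rule order_tendstoD)
  then show ?thesis using eventually_gt_at_top[of 0]
  proof eventually_elim
    case (elim x)
    have "(\<integral>y. (exp (c / x * min y x) - 1) / (c / x) \<partial>M) = ((\<integral>y. exp (c / x * min y x) \<partial>M) - 1) / (c / x)"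
      using int[OF elim(2)] by (simp add: prob_UNIV)
    then show ?case using elim int[of x] c by (auto simp: divide_less_0_iff mult_less_0_iff)
  qed
qed

lemma tail_times_tendsto_0: "((\<lambda>x. x * prob {x<..}) \<longlongrightarrow> 0) at_top"
proof -
  have "((\<lambda>x. \<integral>y. x * indicator {x<..} y \<partial>M) \<longlongrightarrow> (\<integral>y. 0 \<partial>M)) at_top"
  proof (rule integral_dominated_convergence_at_top[where w="\<lambda>y. \<bar>y\<bar>"])
    show "AE y in M. ((\<lambda>x. x * indicator {x<..} y) \<longlongrightarrow> 0) at_top"
    proof (rule AE_I2)
      fix y :: real
      have "\<forall>\<^sub>F x in at_top. x * indicator {x<..} y = 0"
        using eventually_ge_at_top[of y] by eventually_elim auto
      then show "((\<lambda>x. x * indicator {x<..} y) \<longlongrightarrow> 0) at_top"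
        by (rule tendsto_eventually)
    qed
    show "\<forall>\<^sub>F x in at_top. AE y in M. norm (x * indicator {x<..} y) \<le> \<bar>y\<bar>"
      using eventually_ge_at_top[of 0] by eventually_elim (auto simp: indicator_def)
  qed (auto intro: integrable_step)
  then show ?thesis by simp
qed

text \<open>Across a gap of length \<open>e * x\<close> the exponential with rate
  \<open>c / x\<close> decays to \<open>exp (- (c * e))\<close>. So \<open>c\<close> is fixed first,
  then \<open>x\<close> is taken large. Uniformity in \<open>n\<close> and \<open>s\<close> allows
  use at the position reached by a random step.\<close>

lemma overshoot_small:
  assumes z: "0 \<le> z" and e: "e > 0" and d: "d > 0"
  shows "\<forall>\<^sub>F x in at_top. \<forall>n s. - z < s \<longrightarrow> s \<le> (1 - e) * x \<longrightarrow> overshoot M z x n s \<le> d"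
proof -
  obtain B where B: "B \<ge> 0" and neg: "(\<integral>y. max y (- B) \<partial>M) < 0"
    using truncated_drift_neg by auto
  define a where "a = - (\<integral>y. max y (- B) \<partial>M)"
  have a: "a > 0" using neg by (simp add: a_def)
  have mean: "(\<integral>y. max y (- B) \<partial>M) = - a" by (simp add: a_def)
  have "((\<lambda>c. exp (- (c * e))) \<longlongrightarrow> 0) at_top"
    using e by (intro filterlim_compose[OF exp_at_bot])
      (auto simp: filterlim_uminus_at_bot filterlim_at_top_mult_tendsto_pos[OF tendsto_const] filterlim_ident)
  then have "\<forall>\<^sub>F c in at_top. exp (- (c * e)) < d / 2"
    using d by (intro order_tendstoD) auto
  then have "\<forall>\<^sub>F c in at_top. 0 < c \<and> exp (- (c * e)) < d / 2"
    using eventually_gt_at_top[of 0] by eventually_elim auto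
  then obtain c where c: "c > 0" "exp (- (c * e)) < d / 2"
    by (auto dest: eventually_happens)
  \<comment> \<open>This is the linear part of the supersolution \<open>V\<close> below, evaluated
    at \<open>s = x\<close>, its largest value on the relevant range.\<close>
  have lim: "((\<lambda>x. x * prob {x<..} * ((1 + (z + B) / x) / a)) \<longlongrightarrow> 0 * ((1 + 0) / a)) at_top"
    using a by (intro tendsto_intros tail_times_tendsto_0 tendsto_divide_0[OF tendsto_const])
      (auto simp: filterlim_at_top_imp_at_infinity filterlim_ident)
  then have "\<forall>\<^sub>F x in at_top. x * prob {x<..} * ((1 + (z + B) / x) / a) < d / 2"
    using d by (intro order_tendstoD(2)) auto
  then show ?thesis
    using exp_truncated_le_1[OF c(1)] eventually_gt_at_top[of 0]
  proof eventually_elim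
    case (elim x)
    have x: "x > 0" by fact
    have int: "integrable M (\<lambda>y. exp (c / x * min y x))" using elim by auto
    \<comment> \<open>\<open>V\<close> is a supersolution of the recursion for \<open>overshoot\<close>: the exponential controls the
      walk with steps truncated at \<open>x\<close>, and the linear term pays for the steps larger than \<open>x\<close>,
      since it bounds their expected number.\<close>
    define V where "V s = exp (c / x * (s - x)) + prob {x<..} * ((s + z + B) / a)" for s
    have V: "overshoot M z x n s \<le> V s" if "-z < s" "s \<le> x" for n s
      using that
    proof (induction n arbitrary: s)
      case 0
      then show ?case using a B x by (auto simp: overshoot_0 V_def intro!: add_nonneg_nonneg)
    next
      case (Suc n)
      have "overshoot M z x (Suc n) s = (\<integral>y. overshoot M z x n (s + y) \<partial>M)"
        using Suc.prems by (rule overshoot_Suc)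
      also have "\<dots> \<le> (\<integral>y. indicator {x<..} y + (exp (c / x * (s - x)) * exp (c / x * min y x)
           + prob {x<..} * ((s + z + B + max y (- B)) / a)) \<partial>M)"
      proof (rule integral_mono)
        fix y :: real
        let ?E = "exp (c / x * (s - x)) * exp (c / x * min y x)"
        let ?P = "prob {x<..} * ((s + z + B + max y (- B)) / a)"
        have P: "0 \<le> ?P" using a Suc.prems by (intro mult_nonneg_nonneg) auto
        consider "y > x" | "y \<le> x" "s + y > x" | "y \<le> x" "s + y \<le> x" "- z < s + y" | "s + y \<le> - z" 
          by linarith
        then show "overshoot M z x n (s + y) \<le> indicator {x<..} y + (?E + ?P)"
        proof cases
          case 1
          then show ?thesis using overshoot_le_1[of z x n "s + y"] P by (auto intro!: add_increasing2)
        next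
          case 2
          \<comment> \<open>Here \<open>min y x = y\<close>, and the walk lands above
            \<open>x\<close>, so the exponential term alone is at least 1.\<close>
          have "0 \<le> c / x * (s - x + min y x)" using 2 c x by simp
          then have "0 \<le> c / x * (s - x) + c / x * min y x" by (simp only: distrib_left)
          then have "1 \<le> ?E" by (simp flip: exp_add)
          then show ?thesis using overshoot_le_1[of z x n "s + y"] P 2 by auto
        next
          case 3
          have "overshoot M z x n (s + y) \<le> V (s + y)" using 3 by (intro Suc.IH) auto
          also have "exp (c / x * (s + y - x)) = ?E"
            using 3 by (simp add: algebra_simps add_divide_distrib diff_divide_distrib flip: exp_add)
          then have "V (s + y) = ?E + prob {x<..} * ((s + y + z + B) / a)"
            by (simp add: V_def)
          also have "\<dots> \<le> ?E + ?P" using a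
            by (intro add_left_mono mult_left_mono divide_right_mono) auto
          finally show ?thesis using 3 by simp
        next
          case 4
          then have "overshoot M z x n (s + y) = 0" using x z by (intro overshoot_below) auto
          then show ?thesis using P by simp
        qed
      qed (intro Bochner_Integration.integrable_add integrable_mult_right integrable_divide
          integrable_overshoot int integrable_max_step integrable_const integrable_real_indicator; simp add: emeasure_eq_measure)+
      also have "\<dots> = prob {x<..} + (exp (c / x * (s - x)) * (\<integral>y. exp (c / x * min y x) \<partial>M)
           + prob {x<..} * ((s + z + B - a) / a))"
        using mean int by (simp add: integrable_max_step prob_UNIV emeasure_eq_measure)
      also have "\<dots> \<le> prob {x<..} + (exp (c / x * (s - x)) * 1 + prob {x<..} * ((s + z + B - a) / a))"
        using elim by (intro add_left_mono add_right_mono mult_left_mono) auto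
      \<comment> \<open>The drift \<open>- a\<close> lowers the linear term by exactly
        \<open>prob {x<..}\<close>, which cancels the cost of the large step.\<close>
      also have "\<dots> = V s" using a by (simp add: V_def field_simps)
      finally show ?case .
    qed
    show ?case
    proof (intro allI impI)
      fix n s assume s: "- z < s" "s \<le> (1 - e) * x"
      have sx: "s \<le> x" using s e x by (smt (verit) mult_le_cancel_right2)
      have "overshoot M z x n s \<le> V s" using s sx by (intro V) auto
      also have "\<dots> \<le> exp (- (c * e)) + prob {x<..} * ((x + z + B) / a)"
        unfolding V_def
      proof (intro add_mono mult_left_mono divide_right_mono)
        have "c / x * (s - x) \<le> c / x * (- e * x)"
          using c x s by (intro mult_left_mono) (auto simp: algebra_simps)
        then show "exp (c / x * (s - x)) \<le> exp (- (c * e))" using x by simp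
      qed (use a sx in auto)
      also have "prob {x<..} * ((x + z + B) / a) = x * prob {x<..} * ((1 + (z + B) / x) / a)"
        using x a by (simp add: field_simps)
      also have "exp (- (c * e)) + \<dots> \<le> d" using elim c by linarith
      finally show "overshoot M z x n s \<le> d" .
    qed
  qed
qed

text \<open>Starting below \<open>e / 2 * x\<close>, the walk exceeds \<open>x\<close> either through a step larger than
  \<open>(1 - e) * x\<close> or by first entering \<open>{e / 2 * x<..(1 - e / 2) * x}\<close>, from where
  \<open>x\<close> is rarely reached.\<close>

lemma overshoot_le:
  assumes z: "0 \<le> z" and e: "0 < e" "e \<le> 1" and x: "0 < x" and d: "0 \<le> d"
    and small: "\<And>n s. - z < s \<Longrightarrow> s \<le> (1 - e / 2) * x \<Longrightarrow> overshoot M z x n s \<le> d"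
    and s: "- z < s" "s \<le> e / 2 * x"
  shows "overshoot M z x n s \<le>
    (\<Sum>k<n. survival M z k s) * prob {(1 - e) * x<..} + d * overshoot M z (e / 2 * x) n s"
  using s
proof (induction n arbitrary: s)
  case 0
  have "e / 2 * x \<le> 1 * x" using e x by (intro mult_right_mono) auto
  with 0 have "overshoot M z x 0 s = 0" by (intro overshoot_0) auto
  then show ?case using d by (simp add: overshoot_nonneg)
next
  case (Suc n)
  let ?F = "prob {(1 - e) * x<..}" and ?w = "e / 2 * x"
  have "?w \<le> 1 * x" using e x by (intro mult_right_mono) auto
  then have wx: "?w \<le> x" by simp
  have w: "0 < ?w" using e x by simp
  have "overshoot M z x (Suc n) s = (\<integral>y. overshoot M z x n (s + y) \<partial>M)"
    using Suc.prems wx by (intro overshoot_Suc) auto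
  \<comment> \<open>The three terms account for a large step now, a large step later, and an entry
    above \<open>e / 2 * x\<close>.\<close>
  also have "\<dots> \<le> (\<integral>y. indicator {(1 - e) * x<..} y + (\<Sum>k<n. survival M z k (s + y)) * ?F
      + d * overshoot M z ?w n (s + y) \<partial>M)"
  proof (rule integral_mono)
    fix y :: real
    have S: "0 \<le> (\<Sum>k<n. survival M z k (s + y)) * ?F"
      by (intro mult_nonneg_nonneg sum_nonneg survival_nonneg) auto
    have D: "0 \<le> d * overshoot M z ?w n (s + y)"
      using d by (simp add: overshoot_nonneg)
    consider "y > (1 - e) * x" | "y \<le> (1 - e) * x" "s + y > ?w" | "y \<le> (1 - e) * x" "s + y \<le> ?w" "- z < s + y" | "s + y \<le> - z"
      by linarith
    then show "overshoot M z x n (s + y) \<le> indicator {(1 - e) * x<..} y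
        + (\<Sum>k<n. survival M z k (s + y)) * ?F + d * overshoot M z ?w n (s + y)"
    proof cases
      case 1
      then show ?thesis using overshoot_le_1[of z x n "s + y"] S D by simp
    next
      case 2
      have "s + y \<le> ?w + (1 - e) * x" using 2 Suc.prems by linarith
      also have "\<dots> = (1 - e / 2) * x" by (simp add: algebra_simps)
      finally have "overshoot M z x n (s + y) \<le> d"
        using 2 w z by (intro small) auto
      then show ?thesis using 2 S by (simp add: overshoot_above)
    next
      case 3
      then show ?thesis using Suc.IH[of "s + y"] by simp
    next
      case 4
      then have "overshoot M z x n (s + y) = 0" using x z by (intro overshoot_below) auto
      then show ?thesis using S D by simp
    qed
  qed (intro Bochner_Integration.integrable_add integrable_mult_left
      integrable_mult_right
      integrable_overshoot integrable_sum_survival integrable_real_indicator; simp add: emeasure_eq_measure)+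
  \<comment> \<open>Since \<open>s \<le> e / 2 * x\<close>, the start is inside the strip of the
    lower level too, so that integral is \<open>overshoot\<close> at time
    \<open>Suc n\<close>.\<close>
  also have "\<dots> = ?F + (\<integral>y. (\<Sum>k<n. survival M z k (s + y)) \<partial>M) * ?F
      + d * overshoot M z ?w (Suc n) s"
    using Suc.prems by (simp add: integrable_overshoot integrable_survival overshoot_Suc
        emeasure_eq_measure del: Bochner_Integration.integral_sum)
  also have "\<dots> = (\<Sum>k<Suc n. survival M z k s) * ?F + d * overshoot M z ?w (Suc n) s"
    unfolding sum_survival_Suc[OF Suc.prems(1)] by (simp add: algebra_simps)
  finally show ?case .
qed

section \<open>Comparison of the overshoot probability with the step tail\<close>

text \<open>The choice \<open>e = 1 / 2\<close> in \<open>overshoot_le\<close> gives the arguments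
  \<open>x / 2\<close> and \<open>x / 4\<close> of \<open>tail_recursion_bound\<close>; regular
  variation at ratio 1/4 supplies \<open>A\<close>, and \<open>overshoot_small\<close> supplies the
  factor \<open>1 / (2 * A)\<close>.\<close>

lemma overshoot_le_const_tail:
  assumes z: "0 < z" and pos: "\<And>x. 0 < prob {x<..}"
    and reg: "\<And>c. 0 < c \<Longrightarrow> ((\<lambda>x. prob {c * x<..} / prob {x<..}) \<longlongrightarrow> c powr (- r)) at_top"
    and T: "\<And>n. (\<Sum>k<n. survival M z k 0) \<le> T"
  shows "\<exists>K\<ge>0. \<forall>\<^sub>F x in at_top. \<forall>n. overshoot M z x n 0 \<le> K * prob {x<..}"
proof -
  define A where "A = (1/4) powr (- r) + (1::real)"
  have A: "A > 0" by (auto simp: A_def intro: add_nonneg_pos)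
  have "\<forall>\<^sub>F x in at_top. prob {1/4 * x<..} / prob {x<..} < A"
    using reg[of "1/4"] by (intro order_tendstoD(2)) (auto simp: A_def)
  moreover have "\<forall>\<^sub>F x in at_top. \<forall>n s. - z < s \<longrightarrow> s \<le> (1 - 1/4) * x \<longrightarrow> overshoot M z x n s \<le> 1 / (2 * A)"
    using z A by (intro overshoot_small) auto
  ultimately have "\<forall>\<^sub>F x in at_top. prob {1/4 * x<..} / prob {x<..} < A \<and>
      (\<forall>n s. - z < s \<longrightarrow> s \<le> (1 - 1/4) * x \<longrightarrow> overshoot M z x n s \<le> 1 / (2 * A))"
    by (rule eventually_conj)
  then obtain x1 where x1: "\<And>x. x \<ge> x1 \<Longrightarrow> prob {1/4 * x<..} / prob {x<..} < A"
      "\<And>x n s. x \<ge> x1 \<Longrightarrow> - z < s \<Longrightarrow> s \<le> (1 - 1/4) * x \<Longrightarrow> overshoot M z x n s \<le> 1 / (2 * A)"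
    by (auto simp: eventually_at_top_linorder)
  define x0 where "x0 = max x1 1"
  have x0: "x0 > 0" "x1 \<le> x0" by (auto simp: x0_def)
  have T0: "T \<ge> 0" using T[of 0] by simp
  have "overshoot M z x n 0 \<le> max (2 * T * A) (1 / prob {4 * x0<..}) * prob {x<..}" if "x \<ge> x0" for x n
  proof (rule tail_recursion_bound[where G="\<lambda>x. overshoot M z x n 0" and F="\<lambda>x. prob {x<..}"])
    show "prob {x / 4<..} \<le> A * prob {x<..}" if "x \<ge> x0" for x
      using x1(1)[of x] that x0 pos[of x] by (simp add: field_simps)
    show "overshoot M z x n 0 \<le> T * prob {x / 2<..} + overshoot M z (x / 4) n 0 / (2 * A)" if "x \<ge> x0" for x
    proof -
      have "overshoot M z x n 0 \<le> (\<Sum>k<n. survival M z k 0) * prob {(1 - 1/2) * x<..}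
          + 1 / (2 * A) * overshoot M z (1/2 / 2 * x) n 0"
        using z A x0 that by (intro overshoot_le x1(2)) auto
      also have "\<dots> \<le> T * prob {(1 - 1/2) * x<..} + 1 / (2 * A) * overshoot M z (1/2 / 2 * x) n 0"
        by (intro add_right_mono mult_right_mono T) auto
      finally show ?thesis by simp
    qed
    show "antimono (\<lambda>x. prob {x<..})"
      by (intro antimonoI finite_measure_mono) auto
  qed (use that x0 T0 A pos overshoot_le_1 in auto)
  then have "\<forall>\<^sub>F x in at_top. \<forall>n. overshoot M z x n 0
      \<le> max (2 * T * A) (1 / prob {4 * x0<..}) * prob {x<..}"
    by (auto simp: eventually_at_top_linorder)
  moreover have "0 \<le> max (2 * T * A) (1 / prob {4 * x0<..})"
    by (simp add: le_max_iff_disj)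
  ultimately show ?thesis by blast
qed

text \<open>Because \<open>K\<close> is obtained before \<open>e\<close> and \<open>q\<close>, the
  second term of \<open>overshoot_le\<close> contributes only
  \<open>q * K * (e / 2) powr (- r)\<close> relative to the tail. Thus \<open>e\<close> is chosen
  first, then \<open>q\<close> depending on \<open>e\<close>, and finally \<open>x\<close>.\<close>

lemma overshoot_le_tail:
  assumes z: "0 < z" and pos: "\<And>x. 0 < prob {x<..}"
    and reg: "\<And>c. 0 < c \<Longrightarrow> ((\<lambda>x. prob {c * x<..} / prob {x<..}) \<longlongrightarrow> c powr (- r)) at_top"
    and T: "\<And>n. (\<Sum>k<n. survival M z k 0) \<le> T"
    and d: "0 < d"
  shows "\<forall>\<^sub>F x in at_top. \<forall>n. overshoot M z x n 0 \<le> (T + d) * prob {x<..}"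
proof -
  obtain K where K: "K \<ge> 0" "\<forall>\<^sub>F x in at_top. \<forall>n. overshoot M z x n 0 \<le> K * prob {x<..}"
    using overshoot_le_const_tail[OF z pos reg T] by auto
  have "((\<lambda>e. T * (1 - e) powr (- r)) \<longlongrightarrow> T * (1 - 0) powr (- r)) (at_right (0::real))"
    by (intro tendsto_intros) auto
  then have "\<forall>\<^sub>F e in at_right 0. T * (1 - e) powr (- r) < T + d"
    using d by (intro order_tendstoD(2)) auto
  then have "\<forall>\<^sub>F e in at_right 0. e \<in> {0<..<1::real} \<and> T * (1 - e) powr (- r) < T + d"
    by (intro eventually_conj eventually_at_right_real) auto
  then obtain e where e: "0 < e" "e < 1" "T * (1 - e) powr (- r) < T + d"
    by (auto dest!: eventually_happens)
  have "((\<lambda>q. T * (1 - e) powr (- r) + q * (K * (e / 2) powr (- r))) \<longlongrightarrow>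
      T * (1 - e) powr (- r) + 0 * (K * (e / 2) powr (- r))) (at_right 0)"
    by (intro tendsto_intros)
  then have "\<forall>\<^sub>F q in at_right 0. T * (1 - e) powr (- r) + q * (K * (e / 2) powr (- r)) < T + d"
    using e by (intro order_tendstoD(2)) auto
  then have "\<forall>\<^sub>F q in at_right 0. q \<in> {0<..<1::real} \<and>
      T * (1 - e) powr (- r) + q * (K * (e / 2) powr (- r)) < T + d"
    by (intro eventually_conj eventually_at_right_real) auto
  then obtain q where q: "0 < q" "T * (1 - e) powr (- r) + q * (K * (e / 2) powr (- r)) < T + d"
    by (auto dest!: eventually_happens)
  have "((\<lambda>x. T * (prob {(1 - e) * x<..} / prob {x<..}) + q * (K * (prob {e / 2 * x<..} / prob {x<..})))
      \<longlongrightarrow> T * (1 - e) powr (- r) + q * (K * (e / 2) powr (- r))) at_top"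
    using e by (intro tendsto_intros reg) auto
  then have "\<forall>\<^sub>F x in at_top. T * (prob {(1 - e) * x<..} / prob {x<..})
      + q * (K * (prob {e / 2 * x<..} / prob {x<..})) < T + d"
    using q(2) by (rule order_tendstoD(2))
  moreover have "\<forall>\<^sub>F x in at_top. \<forall>n. overshoot M z (e / 2 * x) n 0 \<le> K * prob {e / 2 * x<..}"
    using e by (intro eventually_compose_filterlim[OF K(2)] 
        filterlim_tendsto_pos_mult_at_top[OF tendsto_const _ filterlim_ident]) auto
  moreover have "\<forall>\<^sub>F x in at_top. \<forall>n s. - z < s \<longrightarrow> s \<le> (1 - e / 2) * x \<longrightarrow> overshoot M z x n s \<le> q"
    using z e q by (intro overshoot_small) auto
  ultimately show ?thesis using eventually_gt_at_top[of 0]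
  proof eventually_elim
    case (elim x)
    show ?case
    proof
      fix n
      have "overshoot M z x n 0 \<le> (\<Sum>k<n. survival M z k 0) * prob {(1 - e) * x<..}
          + q * overshoot M z (e / 2 * x) n 0"
        using z e q elim by (intro overshoot_le) auto
      also have "\<dots> \<le> T * prob {(1 - e) * x<..} + q * (K * prob {e / 2 * x<..})"
        using elim(2) q by (intro add_mono mult_right_mono mult_left_mono T) auto
      also have "\<dots> = (T * (prob {(1 - e) * x<..} / prob {x<..})
          + q * (K * (prob {e / 2 * x<..} / prob {x<..}))) * prob {x<..}"
        using pos[of x] by (simp add: distrib_right)
      also have "\<dots> \<le> (T + d) * prob {x<..}"
        using elim(1) by (intro mult_right_mono) auto
      finally show "overshoot M z x n 0 \<le> (T + d) * prob {x<..}" .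
    qed
  qed
qed

end

section \<open>Path properties of the absorbed walk\<close>

lemma absorbed_walk_cong:
  "(\<And>i. 1 \<le> i \<Longrightarrow> i \<le> n \<Longrightarrow> u i = v i) \<Longrightarrow> absorbed_walk R u n = absorbed_walk R v n"
  by (induction n) auto

lemma measurable_absorbed_walk:
  assumes [measurable]: "R \<in> sets borel" and "{1..n} \<subseteq> A"
  shows "(\<lambda>v. absorbed_walk R v n) \<in> borel_measurable (Pi\<^sub>M A (\<lambda>_. borel))"
  using assms(2)
proof (induction n)
  case (Suc n)
  then have [measurable]: "(\<lambda>v. absorbed_walk R v n) \<in> borel_measurable (Pi\<^sub>M A (\<lambda>_. borel))"
    and A: "Suc n \<in> A" by (auto simp: atLeastAtMostSuc_conv)
  note [measurable] = measurable_component_singleton[OF A]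
  show ?case by simp
qed simp

lemma absorbed_walk_eq_sum:
  "(\<And>k. k < n \<Longrightarrow> (\<Sum>i=1..k. y i) \<in> R) \<Longrightarrow> absorbed_walk R y n = (\<Sum>i=1..n. y i)"
  by (induction n) auto

lemma sum_in_if_absorbed_walk_in:
  "absorbed_walk R y n \<in> R \<Longrightarrow> \<forall>k\<le>n. (\<Sum>i=1..k. y i) \<in> R"
proof (induction n)
  case (Suc n)
  have n: "absorbed_walk R y n \<in> R" using Suc.prems(1) by (auto split: if_splits)
  then have "absorbed_walk R y (Suc n) = (\<Sum>i=1..Suc n. y i)"
    using Suc.IH[OF n] by (intro absorbed_walk_eq_sum) auto
  then show ?case using Suc.prems Suc.IH[OF n] by (auto simp: le_Suc_eq)
qed simp

text \<open>A path that has left \<open>R\<close> is frozen outside, so being in \<open>R\<close> at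
  time \<open>n\<close> records the whole past.\<close>

lemma absorbed_walk_in_iff:
  "absorbed_walk R y n \<in> R \<longleftrightarrow> (\<forall>k\<le>n. (\<Sum>i=1..k. y i) \<in> R)"
  using sum_in_if_absorbed_walk_in[of R y n] absorbed_walk_eq_sum[of n y R] by auto

section \<open>Walks with i.i.d. steps: the recursions as probabilities\<close>

locale iid_steps = prob_space M for M :: "'a measure" +
  fixes Y :: "nat \<Rightarrow> 'a \<Rightarrow> real" and \<mu> :: "real measure"
  assumes indep: "indep_vars (\<lambda>_. borel) Y {1..}"
    and distr_step: "\<And>i. 1 \<le> i \<Longrightarrow> distr M borel (Y i) = \<mu>"
begin

abbreviation walk :: "real set \<Rightarrow> nat \<Rightarrow> 'a \<Rightarrow> real" where
  "walk R n \<omega> \<equiv> absorbed_walk R (\<lambda>i. Y i \<omega>) n"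

lemma measurable_step [measurable]: "Y (Suc i) \<in> borel_measurable M"
  using indep by (auto simp: indep_vars_def)

lemma walk_restrict: "walk R n \<omega> = absorbed_walk R (\<lambda>i\<in>{1..n}. Y i \<omega>) n"
  by (rule absorbed_walk_cong) auto

lemma measurable_walk [measurable]:
  assumes [measurable]: "R \<in> sets borel"
  shows "walk R n \<in> borel_measurable M"
  by (induction n) auto

lemma measurable_random_walk [measurable]: "random_walk Y n \<in> borel_measurable M"
proof -
  have "Y i \<in> borel_measurable M" if "i \<in> {1..n}" for i
    using that measurable_step[of "i - 1"] by simp
  then show ?thesis unfolding random_walk_def by (intro borel_measurable_sum)
qed

lemma real_distribution_step: "real_distribution \<mu>"
  using prob_space_distr[OF measurable_step[of 0]] distr_step[of 1]
  by (auto simp: real_distribution_def real_distribution_axioms_def)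

sublocale step: real_distribution \<mu>
  by (rule real_distribution_step)

text \<open>The stopped walk at time \<open>n\<close> is a measurable function of the first
  \<open>n\<close> increments, a block disjoint from the next one.\<close>

lemma indep_walk_step:
  assumes R: "R \<in> sets borel"
  shows "indep_var borel (walk R n) borel (Y (Suc n))"
proof -
  have "indep_var (Pi\<^sub>M {1..n} (\<lambda>_. borel)) (\<lambda>\<omega>. \<lambda>i\<in>{1..n}. Y i \<omega>)
      (Pi\<^sub>M {Suc n} (\<lambda>_. borel)) (\<lambda>\<omega>. \<lambda>i\<in>{Suc n}. Y i \<omega>)"
    by (rule indep_var_restrict[OF indep]) auto
  then have "indep_var borel ((\<lambda>v. absorbed_walk R v n) \<circ> (\<lambda>\<omega>. \<lambda>i\<in>{1..n}. Y i \<omega>))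
      borel ((\<lambda>v. v (Suc n)) \<circ> (\<lambda>\<omega>. \<lambda>i\<in>{Suc n}. Y i \<omega>))"
    by (rule indep_var_compose) (auto intro: measurable_absorbed_walk R)
  moreover have "(\<lambda>v. absorbed_walk R v n) \<circ> (\<lambda>\<omega>. \<lambda>i\<in>{1..n}. Y i \<omega>) = walk R n"
    by (simp only: comp_def walk_restrict)
  ultimately show ?thesis by (simp add: comp_def)
qed

text \<open>By independence the joint law of position and next step is a product, so Fubini
  integrates out the last step.\<close>

lemma expectation_walk_Suc:
  fixes f :: "real \<Rightarrow> real"
  assumes [measurable]: "R \<in> sets borel" "f \<in> borel_measurable borel"
    and f: "\<And>s. 0 \<le> f s" "\<And>s. f s \<le> 1"
  shows "expectation (\<lambda>\<omega>. f (walk R (Suc n) \<omega>)) =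
    expectation (\<lambda>\<omega>. if walk R n \<omega> \<in> R then \<integral>y. f (walk R n \<omega> + y) \<partial>\<mu> else f (walk R n \<omega>))"
proof -
  define \<nu> where "\<nu> = distr M borel (walk R n)"
  interpret nu: real_distribution \<nu>
    using prob_space_distr[OF measurable_walk[of R n]]
    by (auto simp: \<nu>_def real_distribution_def real_distribution_axioms_def)
  interpret pair: pair_prob_space \<nu> \<mu> ..
  let ?g = "\<lambda>(s, y). if s \<in> R then f (s + y) else f s"
  have joint: "distr M (borel \<Otimes>\<^sub>M borel) (\<lambda>\<omega>. (walk R n \<omega>, Y (Suc n) \<omega>)) = \<nu> \<Otimes>\<^sub>M \<mu>"
    using indep_walk_step[of R n] distr_step[of "Suc n"]
    by (simp add: indep_var_distribution_eq \<nu>_def)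
  have sets [measurable_cong]: "sets (\<nu> \<Otimes>\<^sub>M \<mu>) = sets (borel \<Otimes>\<^sub>M borel)"
    by (intro sets_pair_measure_cong) auto
  have "expectation (\<lambda>\<omega>. f (walk R (Suc n) \<omega>)) = expectation (\<lambda>\<omega>. ?g (walk R n \<omega>, Y (Suc n) \<omega>))"
    by (intro Bochner_Integration.integral_cong) auto
  also have "\<dots> = integral\<^sup>L (\<nu> \<Otimes>\<^sub>M \<mu>) ?g"
    unfolding joint[symmetric] by (subst integral_distr) auto
  also have "\<dots> = (\<integral>s. \<integral>y. ?g (s, y) \<partial>\<mu> \<partial>\<nu>)"
  proof (rule pair.integral_fst'[symmetric])
    show "integrable (\<nu> \<Otimes>\<^sub>M \<mu>) ?g"
      by (rule pair.P.integrable_const_bound[where B=1]) (auto simp: f)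
  qed
  also have "\<dots> = (\<integral>s. (if s \<in> R then \<integral>y. f (s + y) \<partial>\<mu> else f s) \<partial>\<nu>)"
    by (intro Bochner_Integration.integral_cong) (auto simp: step.prob_UNIV)
  also have "\<dots> = expectation (\<lambda>\<omega>. if walk R n \<omega> \<in> R then \<integral>y. f (walk R n \<omega> + y) \<partial>\<mu> else f (walk R n \<omega>))"
    unfolding \<nu>_def by (subst integral_distr) auto
  finally show ?thesis .
qed

lemma expectation_walk:
  assumes [measurable]: "R \<in> sets borel" "f \<in> borel_measurable borel"
    and f: "\<And>s. 0 \<le> f s" "\<And>s. f s \<le> 1"
  shows "expectation (\<lambda>\<omega>. f (walk R n \<omega>)) = absorbed_mean \<mu> R f n 0"
proof -
  \<comment> \<open>The recursion conditions on the first step, whereas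
    \<open>expectation_walk_Suc\<close> removes the last one. Generalising over \<open>k\<close>
    reconciles them: steps move one by one from the path into \<open>absorbed_mean\<close>, until
    \<open>k = 0\<close>.\<close>
  have "expectation (\<lambda>\<omega>. f (walk R (k + n) \<omega>)) = expectation (\<lambda>\<omega>. absorbed_mean \<mu> R f n (walk R k \<omega>))" for k
  proof (induction n arbitrary: k)
    case (Suc n)
    have "expectation (\<lambda>\<omega>. f (walk R (k + Suc n) \<omega>))
        = expectation (\<lambda>\<omega>. absorbed_mean \<mu> R f n (walk R (Suc k) \<omega>))"
      using Suc.IH[of "Suc k"] by simp
    also have "\<dots> = expectation (\<lambda>\<omega>. if walk R k \<omega> \<in> R
        then \<integral>y. absorbed_mean \<mu> R f n (walk R k \<omega> + y) \<partial>\<mu> else absorbed_mean \<mu> R f n (walk R k \<omega>))"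
      by (rule expectation_walk_Suc) (auto intro: step.absorbed_mean_bounds f)
    also have "\<dots> = expectation (\<lambda>\<omega>. absorbed_mean \<mu> R f (Suc n) (walk R k \<omega>))"
      by (intro Bochner_Integration.integral_cong) (auto simp: absorbed_mean_outside)
    finally show ?case .
  qed simp
  from this[of 0] show ?thesis by (simp add: prob_space)
qed

lemma prob_overshoot: "prob {\<omega> \<in> space M. x < walk {-z<..x} n \<omega>} = overshoot \<mu> z x n 0"
proof -
  have "prob {\<omega> \<in> space M. x < walk {-z<..x} n \<omega>} = expectation (indicator {\<omega> \<in> space M. x < walk {-z<..x} n \<omega>})"
    by (subst Bochner_Integration.integral_indicator) (auto intro!: arg_cong[where f=prob])
  also have "\<dots> = expectation (\<lambda>\<omega>. indicator {x<..} (walk {-z<..x} n \<omega>))"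
    by (intro Bochner_Integration.integral_cong) (auto simp: indicator_def)
  also have "\<dots> = overshoot \<mu> z x n 0"
    unfolding overshoot_def by (rule expectation_walk) auto
  finally show ?thesis .
qed

lemma prob_survival: "prob {\<omega> \<in> space M. \<forall>k\<le>n. - z < random_walk Y k \<omega>} = survival \<mu> z n 0"
proof -
  have "prob {\<omega> \<in> space M. \<forall>k\<le>n. - z < random_walk Y k \<omega>}
      = expectation (indicator {\<omega> \<in> space M. \<forall>k\<le>n. - z < random_walk Y k \<omega>})"
    by (subst Bochner_Integration.integral_indicator) (auto intro!: arg_cong[where f=prob])
  also have "\<dots> = expectation (\<lambda>\<omega>. indicator {-z<..} (walk {-z<..} n \<omega>))"
    by (intro Bochner_Integration.integral_cong)
      (auto simp: indicator_def random_walk_def absorbed_walk_in_iff[of "{-z<..}", simplified])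
  also have "\<dots> = survival \<mu> z n 0"
    unfolding survival_def by (rule expectation_walk) auto
  finally show ?thesis .
qed

section \<open>Passage time and maximum\<close>

lemma measurable_passage_time [measurable]: "passage_time Y z \<in> measurable M (count_space UNIV)"
  unfolding passage_time_def by measurable

text \<open>The assumption guarantees that the \<open>LEAST\<close> is attained; it holds almost
  surely by \<open>AE_passage\<close>.\<close>

lemma less_passage_time_iff:
  assumes "random_walk Y m \<omega> \<le> - z"
  shows "n < passage_time Y z \<omega> \<longleftrightarrow> (\<forall>k\<le>n. - z < random_walk Y k \<omega>)"
proof -
  have "random_walk Y (passage_time Y z \<omega>) \<omega> \<le> - z"
    unfolding passage_time_def by (rule LeastI) (rule assms)
  moreover have "passage_time Y z \<omega> \<le> k" if "random_walk Y k \<omega> \<le> - z" for k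
    unfolding passage_time_def by (rule Least_le) (rule that)
  ultimately show ?thesis by (meson leD le_less_trans not_le_imp_less)
qed

lemma AE_passage:
  assumes "(\<lambda>n. survival \<mu> z n 0) \<longlonglongrightarrow> 0"
  shows "AE \<omega> in M. \<exists>n. random_walk Y n \<omega> \<le> - z"
proof -
  let ?N = "{\<omega> \<in> space M. \<forall>n. - z < random_walk Y n \<omega>}"
  have "prob ?N \<le> survival \<mu> z n 0" for n
    unfolding prob_survival[symmetric] by (intro finite_measure_mono) auto
  then have "prob ?N \<le> 0"
    using assms by (intro LIMSEQ_le_const) auto
  then have "prob ?N = 0" by (simp add: measure_le_0_iff)
  then have "AE \<omega> in M. \<omega> \<notin> ?N"
    by (intro AE_not_in) (simp add: null_sets_def emeasure_eq_measure)
  then show ?thesis by (auto simp: not_less)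
qed

text \<open>The tail-sum formula for a natural-valued variable. Summability makes the nonnegative
  integral finite, so the Bochner integral has this value and not the default 0.\<close>

lemma expectation_passage_time:
  assumes "summable (\<lambda>n. survival \<mu> z n 0)"
  shows "expectation (\<lambda>\<omega>. real (passage_time Y z \<omega>)) = (\<Sum>n. survival \<mu> z n 0)"
proof -
  have AE: "AE \<omega> in M. \<exists>n. random_walk Y n \<omega> \<le> - z"
    by (intro AE_passage summable_LIMSEQ_zero assms)
  have "emeasure M {\<omega> \<in> space M. t < passage_time Y z \<omega>} = ennreal (survival \<mu> z t 0)" for t
  proof -
    have "emeasure M {\<omega> \<in> space M. t < passage_time Y z \<omega>}
        = emeasure M {\<omega> \<in> space M. \<forall>k\<le>t. - z < random_walk Y k \<omega>}"
      using AE by (intro emeasure_eq_AE) (auto elim!: eventually_mono simp: less_passage_time_iff)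
    then show ?thesis by (simp add: emeasure_eq_measure prob_survival)
  qed
  then have "(\<integral>\<^sup>+\<omega>. of_nat (passage_time Y z \<omega>) \<partial>M) = (\<Sum>t. ennreal (survival \<mu> z t 0))"
    by (simp add: nn_integral_nat_function)
  also have "\<dots> = ennreal (\<Sum>t. survival \<mu> z t 0)"
    by (intro suminf_ennreal2 step.survival_nonneg assms)
  finally have "(\<integral>\<^sup>+\<omega>. ennreal (real (passage_time Y z \<omega>)) \<partial>M) = ennreal (\<Sum>t. survival \<mu> z t 0)"
    by (simp add: ennreal_of_nat_eq_real_of_nat)
  moreover have "0 \<le> (\<Sum>t. survival \<mu> z t 0)"
    by (intro suminf_nonneg assms step.survival_nonneg)
  ultimately show ?thesis
    by (intro integral_eq_nn_integral[THEN trans]) auto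
qed

lemma prob_passage_max_le:
  assumes AE: "AE \<omega> in M. \<exists>n. random_walk Y n \<omega> \<le> - z"
    and z: "0 < z" and x: "0 \<le> x" and C: "\<And>n. overshoot \<mu> z x n 0 \<le> C"
  shows "prob {\<omega> \<in> space M. x < passage_max Y z \<omega>} \<le> C"
proof -
  let ?R = "{-z<..x}"
  define E where "E n = {\<omega> \<in> space M. x < walk ?R n \<omega>}" for n
  have E: "E n \<in> sets M" for n unfolding E_def by measurable
  \<comment> \<open>A walk above \<open>x\<close> is outside \<open>?R\<close> and therefore frozen
    there.\<close>
  have "incseq E"
    unfolding E_def by (rule incseq_SucI) auto
  then have "(\<lambda>n. prob (E n)) \<longlonglongrightarrow> prob (\<Union>n. E n)"
    using E by (intro finite_Lim_measure_incseq) auto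
  then have "prob (\<Union>n. E n) \<le> C"
    by (rule LIMSEQ_le_const2) (use C in \<open>auto simp: E_def prob_overshoot\<close>)
  moreover have "prob {\<omega> \<in> space M. x < passage_max Y z \<omega>} \<le> prob (\<Union>n. E n)"
  proof (rule finite_measure_mono_AE)
    show "AE \<omega> in M. \<omega> \<in> {\<omega> \<in> space M. x < passage_max Y z \<omega>} \<longrightarrow> \<omega> \<in> (\<Union>n. E n)"
      using AE
    proof eventually_elim
      case (elim \<omega>)
      then obtain m where m: "random_walk Y m \<omega> \<le> - z" by auto
      have "0 < passage_time Y z \<omega>"
        using z by (simp add: less_passage_time_iff[OF m] random_walk_def)
      then have ne: "{1..passage_time Y z \<omega>} \<noteq> {}" by simp
      show ?case
      proof
        assume "\<omega> \<in> {\<omega> \<in> space M. x < passage_max Y z \<omega>}"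
        then have \<omega>: "\<omega> \<in> space M" and "x < passage_max Y z \<omega>" by auto
        then obtain j where j: "j \<le> passage_time Y z \<omega>" "x < random_walk Y j \<omega>"
          unfolding passage_max_def using ne by (subst (asm) Max_gr_iff) auto
        \<comment> \<open>At the first exceedance all earlier positions are at most
          \<open>x\<close>, and above \<open>- z\<close> since \<open>k\<close> does not exceed the
          passage time; hence nothing was frozen before \<open>k\<close>.\<close>
        define k where "k = (LEAST j. x < random_walk Y j \<omega>)"
        have k: "x < random_walk Y k \<omega>" unfolding k_def by (rule LeastI) (rule j)
        have kj: "k \<le> j" unfolding k_def by (rule Least_le) (rule j)
        have "random_walk Y i \<omega> \<in> ?R" if "i < k" for i
        proof -
          have "i < passage_time Y z \<omega>" using that kj j by simp
          then show ?thesis using that less_passage_time_iff[OF m, of i] not_less_Least[of i "\<lambda>j. x < random_walk Y j \<omega>"]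
            by (auto simp: k_def)
        qed
        then have "walk ?R k \<omega> = random_walk Y k \<omega>"
          unfolding random_walk_def by (rule absorbed_walk_eq_sum)
        then show "\<omega> \<in> (\<Union>n. E n)" using k \<omega> by (auto simp: E_def intro!: exI[of _ k])
      qed
    qed
  qed (use E in auto)
  ultimately show ?thesis by simp
qed

end

section \<open>Regular variation of the right tail\<close>

text \<open>Comparing \<open>F\<close> with \<open>H\<close> at both \<open>c * x\<close> and
  \<open>x\<close> yields limits \<open>p\<close> that cancel, leaving the ratio of
  \<open>H\<close>, in which \<open>L\<close> contributes 1.\<close>

lemma ratio_regularly_varying:
  fixes F H L :: "real \<Rightarrow> real"
  assumes L: "slowly_varying L" and H: "\<And>x. x > 0 \<Longrightarrow> H x = L x * x powr (- r)"
    and FH: "((\<lambda>x. F x / H x) \<longlongrightarrow> p) at_top" and p: "p \<noteq> 0" and c: "0 < c"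
  shows "((\<lambda>x. F (c * x) / F x) \<longlongrightarrow> c powr (- r)) at_top"
proof -
  have cx: "filterlim (\<lambda>x. c * x) at_top at_top"
    using c by (intro filterlim_tendsto_pos_mult_at_top[OF tendsto_const _ filterlim_ident])
  have "((\<lambda>x. L (c * x) / L x) \<longlongrightarrow> 1) at_top"
    using L c by (simp add: slowly_varying_def)
  then have "((\<lambda>x. (F (c * x) / H (c * x)) * (L (c * x) / L x) * c powr (- r) / (F x / H x))
      \<longlongrightarrow> p * 1 * c powr (- r) / p) at_top"
    by (intro tendsto_intros filterlim_compose[OF FH cx] FH p)
  moreover from L obtain A where "\<forall>x\<ge>A. 0 < L x" by (auto simp: slowly_varying_def)
  then have A: "\<forall>\<^sub>F x in at_top. 0 < L x"
    by (auto simp: eventually_at_top_linorder)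
  have "\<forall>\<^sub>F x in at_top. (F (c * x) / H (c * x)) * (L (c * x) / L x) * c powr (- r) / (F x / H x)
      = F (c * x) / F x"
    using A eventually_compose_filterlim[OF A cx] eventually_gt_at_top[of 0]
  proof eventually_elim
    case (elim x)
    then show ?case using c by (simp add: H powr_mult)
  qed
  ultimately show ?thesis using p
    by (simp add: tendsto_cong)
qed

section \<open>The limit superior of the tail ratio\<close>

theorem corollary5:
  fixes M :: "'a measure"
    and X :: "'a \<Rightarrow> real"
    and Y :: "nat \<Rightarrow> 'a \<Rightarrow> real"
    and L :: "real \<Rightarrow> real"
    and r p :: real
  assumes "prob_space M"
    and "X \<in> borel_measurable M"
    and "prob_space.indep_vars M (\<lambda>_. borel) Y {1..}"
    and "\<And>i. 1 \<le> i \<Longrightarrow> distr M borel (Y i) = distr M borel X"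
    and "integrable M X"
    and "- (\<integral>\<omega>. X \<omega> \<partial>M) > 0"
    and "r > 1"
    and "slowly_varying L"
    and "\<And>x. x > 0 \<Longrightarrow> \<P>(\<omega> in M. \<bar>X \<omega>\<bar> > x) = L x * x powr (- r)"
    and "((\<lambda>x. \<P>(\<omega> in M. X \<omega> > x) / \<P>(\<omega> in M. \<bar>X \<omega>\<bar> > x)) \<longlongrightarrow> p) at_top"
    and "0 < p" and "p < 1"
  shows "\<forall>z>0.
    Limsup at_top
      (\<lambda>x::real. ereal (\<P>(\<omega> in M. passage_max Y z \<omega> > x) / \<P>(\<omega> in M. X \<omega> > x)))
    \<le> ereal (\<integral>\<omega>. real (passage_time Y z \<omega>) \<partial>M)"
proof (intro allI impI)
  fix z :: real
  assume z: "z > 0"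
  have [measurable]: "X \<in> borel_measurable M" by fact
  interpret iid_steps M Y "distr M borel X"
    using assms by (simp add: iid_steps_def iid_steps_axioms_def)
  interpret step: negative_drift "distr M borel X"
    using assms(5,6)
    by unfold_locales (auto simp: integrable_distr_eq integral_distr)
  have tail: "step.prob {x<..} = \<P>(\<omega> in M. X \<omega> > x)" for x
    by (subst measure_distr) (auto intro!: arg_cong[where f=prob])
  have reg: "((\<lambda>x. step.prob {c * x<..} / step.prob {x<..}) \<longlongrightarrow> c powr (- r)) at_top" if "0 < c" for c
    unfolding tail using assms(8-11) that by (intro ratio_regularly_varying) auto
  \<comment> \<open>A positive limit \<open>p\<close> makes the right tail positive at arbitrarily
    large arguments, hence everywhere by monotonicity.\<close>
  have pos: "0 < step.prob {x<..}" for x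
  proof -
    have "\<forall>\<^sub>F y in at_top. 0 < \<P>(\<omega> in M. X \<omega> > y) / \<P>(\<omega> in M. \<bar>X \<omega>\<bar> > y)"
      using assms(10,11) by (rule order_tendstoD(1))
    then have "\<forall>\<^sub>F y in at_top. x \<le> y \<and> 0 < \<P>(\<omega> in M. X \<omega> > y) / \<P>(\<omega> in M. \<bar>X \<omega>\<bar> > y)"
      by (intro eventually_conj eventually_ge_at_top)
    then obtain y where "x \<le> y" "0 < \<P>(\<omega> in M. X \<omega> > y)"
      by (auto dest!: eventually_happens simp: zero_less_divide_iff)
    moreover have "step.prob {y<..} \<le> step.prob {x<..}"
      using \<open>x \<le> y\<close> by (intro step.finite_measure_mono) auto
    ultimately show ?thesis by (simp add: tail)
  qed
  obtain B where B: "0 \<le> B" "(\<integral>y. max y (- B) \<partial>distr M borel X) < 0"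
    using step.truncated_drift_neg by auto
  have summable: "summable (\<lambda>n. survival (distr M borel X) z n 0)"
    using step.sum_survival_le[OF B, of z 0] z
    by (intro summableI_nonneg_bounded[where x="(z + B) / - (\<integral>y. max y (- B) \<partial>distr M borel X)"]
          step.survival_nonneg) auto
  define T where "T = expectation (\<lambda>\<omega>. real (passage_time Y z \<omega>))"
  \<comment> \<open>The partial sums are truncated means of the passage time, so its mean bounds
    them uniformly in \<open>n\<close>.\<close>
  have T: "(\<Sum>k<n. survival (distr M borel X) z k 0) \<le> T" for n
    unfolding T_def expectation_passage_time[OF summable]
    by (intro sum_le_suminf summable) (auto intro: step.survival_nonneg)
  have AE: "AE \<omega> in M. \<exists>n. random_walk Y n \<omega> \<le> - z"
    by (intro AE_passage summable_LIMSEQ_zero summable)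
  show "Limsup at_top (\<lambda>x. ereal (\<P>(\<omega> in M. passage_max Y z \<omega> > x) / \<P>(\<omega> in M. X \<omega> > x))) \<le> ereal T"
  proof (rule ereal_le_epsilon2)
    fix d :: real
    assume d: "0 < d"
    have "\<forall>\<^sub>F x in at_top. \<forall>n. overshoot (distr M borel X) z x n 0 \<le> (T + d) * step.prob {x<..}"
      using z pos reg T d by (rule step.overshoot_le_tail)
    then have "\<forall>\<^sub>F x in at_top. ereal (\<P>(\<omega> in M. passage_max Y z \<omega> > x) / \<P>(\<omega> in M. X \<omega> > x)) \<le> ereal (T + d)"
      using eventually_ge_at_top[of 0]
    proof eventually_elim
      case (elim x)
      then have "\<P>(\<omega> in M. passage_max Y z \<omega> > x) \<le> (T + d) * step.prob {x<..}"
        using AE z by (intro prob_passage_max_le) auto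
      then show ?case using pos[of x] by (simp add: tail divide_le_eq)
    qed
    then show "Limsup at_top (\<lambda>x. ereal (\<P>(\<omega> in M. passage_max Y z \<omega> > x) / \<P>(\<omega> in M. X \<omega> > x)))
        \<le> ereal T + ereal d"
      by (simp add: Limsup_bounded)
  qed
qed

end
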